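(* Let $n\in\mathbb{N}$, $k\geq2$, $u\equiv a_{i_1}a_{i_2}\cdots a_{i_k}$ with $a_{i_j}\in\{a_1,\dots,a_n\}$, and let $S=sgp\langle a_1,\dots,a_n\mid u=\varepsilon\rangle$, where $\{u=\varepsilon\}$ is a Gröbner–Shirshov basis. Then $S$ is biautomatic.
   Context: $A^*$ is the free monoid (empty word $\varepsilon$), $A^+=A^*\setminus\{\varepsilon\}$. $sgp\langle A\mid R\rangle$ is the monoid $A^*$ modulo the congruence generated by $R$. Gröbner–Shirshov bases: fix a well-ordering of $A$ and the deg-lex ordering on $A^*$ (length, then lexicographic). For monic polynomials $f,g$ in the free associative algebra $F\langle A\rangle$ over a field with leading words $\bar f,\bar g$: if $w\equiv\bar f b\equiv a\bar g$ with $|\bar f|+|\bar g|>|w|$, $(f,g)_w=fb-ag$; if $w\equiv\bar f\equiv a\bar g b$, $(f,g)_w=f-agb$; trivial modulo $(R,w)$ if it equals $\sum\alpha_i a_i s_i b_i$ with $s_i\in R$, $a_i\bar{s_i}b_i<w$. $R$ is a Gröbner–Shirshov basis if all compositions are trivial; $\{u=\varepsilon\}$ is one if $\{u-1\}$ is. Automaticity: regular = accepted by a finite automaton. With $\$\notin A$, $A(2,\$)=(A\cup\{\$\})^2\setminus\{(\$,\$)\}$; $(\alpha,\beta)\delta_A^R$ (resp. $\delta_A^L$) is the word over $A(2,\$)$ obtained by padding the shorter word on the right (resp. left) with $\$$'s and reading letter pairs. For a semigroup $S$ generated by a finite set $A$, $\phi:A^+\to S$ canonical, $L\subseteq A^+$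 regular with $\phi(L)=S$, write $\alpha=\beta$ if $\phi(\alpha)=\phi(\beta)$, and for $a\in A\cup\{\varepsilon\}$: $L_a^\$=\{(\alpha,\beta)\delta^R_A:\alpha a=\beta\}$, ${}^\$L_a=\{(\alpha,\beta)\delta^L_A:\alpha a=\beta\}$, ${}_aL^\$=\{(\alpha,\beta)\delta^R_A:a\alpha=\beta\}$, ${}^\$_aL=\{(\alpha,\beta)\delta^L_A:a\alpha=\beta\}$ (with $\alpha,\beta\in L$). $S$ is biautomatic if some such $(A,L)$ has all four families regular for all $a\in A\cup\{\varepsilon\}$. A monoid is biautomatic if it is biautomatic as a semigroup (with respect to some finite semigroup generating set). *)

theory Defs
  imports Main
begin

inductive pcong :: "('a list \<times> 'a list) set \<Rightarrow> 'a list \<Rightarrow> 'a list \<Rightarrow> bool"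
  for R :: "('a list \<times> 'a list) set" where
  base: "(x, y) \<in> R \<Longrightarrow> pcong R x y"
| refl: "pcong R x x"
| sym: "pcong R x y \<Longrightarrow> pcong R y x"
| trans: "pcong R x y \<Longrightarrow> pcong R y z \<Longrightarrow> pcong R x z"
| cong: "pcong R x y \<Longrightarrow> pcong R (p @ x @ q) (p @ y @ q)"

definition sgp_carrier :: "('a list \<times> 'a list) set \<Rightarrow> 'a list set set" where
  "sgp_carrier R = {{y. pcong R x y} | x. True}"

definition sgp_mult :: "('a list \<times> 'a list) set \<Rightarrow> 'a list set \<Rightarrow> 'a list set \<Rightarrow> 'a list set" where
  "sgp_mult R X Y = {z. \<exists>x\<in>X. \<exists>y\<in>Y. pcong R z (x @ y)}"

text \<open>Noncommutative polynomials are coefficient functions on words (finite support).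
  The order is deg-lex: length first, then lexicographic w.r.t. the order of the letters.\<close>

definition deglex :: "('a::linorder list \<times> 'a list) set" where
  "deglex = lenlex {(x, y). x < y}"

definition lw :: "('a::linorder list \<Rightarrow> 'k::zero) \<Rightarrow> 'a list" where
  "lw f = (THE w. f w \<noteq> 0 \<and> (\<forall>v. f v \<noteq> 0 \<longrightarrow> v = w \<or> (v, w) \<in> deglex))"

definition monic :: "('a::linorder list \<Rightarrow> 'k::{zero,one}) \<Rightarrow> bool" where
  "monic f \<longleftrightarrow> finite {w. f w \<noteq> 0} \<and> (\<exists>w. f w \<noteq> 0) \<and> f (lw f) = 1"

definition wmul :: "'a list \<Rightarrow> ('a list \<Rightarrow> 'k::zero) \<Rightarrow> 'a list \<Rightarrow> 'a list \<Rightarrow> 'k" where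
  "wmul a f b = (\<lambda>w. if \<exists>v. w = a @ v @ b then f (THE v. w = a @ v @ b) else 0)"

definition trivial_mod :: "('a::linorder list \<Rightarrow> 'k::field) set \<Rightarrow> 'a list \<Rightarrow> ('a list \<Rightarrow> 'k) \<Rightarrow> bool" where
  "trivial_mod R w h \<longleftrightarrow>
     (\<exists>ts :: ('k \<times> 'a list \<times> ('a list \<Rightarrow> 'k) \<times> 'a list) list.
        (\<forall>(\<alpha>, a, s, b) \<in> set ts. s \<in> R \<and> (a @ lw s @ b, w) \<in> deglex) \<and>
        h = (\<lambda>x. \<Sum>(\<alpha>, a, s, b) \<leftarrow> ts. \<alpha> * wmul a s b x))"

definition GSB :: "('a::linorder list \<Rightarrow> 'k::field) set \<Rightarrow> bool" where
  "GSB R \<longleftrightarrow> (\<forall>f\<in>R. monic f) \<and>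
     (\<forall>f\<in>R. \<forall>g\<in>R.
        (\<forall>a b w. w = lw f @ b \<and> w = a @ lw g \<and> length (lw f) + length (lw g) > length w
            \<longrightarrow> trivial_mod R w (\<lambda>x. wmul [] f b x - wmul a g [] x)) \<and>
        (\<forall>a b. lw f = a @ lw g @ b \<longrightarrow> trivial_mod R (lw f) (\<lambda>x. f x - wmul a g b x)))"

definition rel_poly :: "'a list \<Rightarrow> 'a list \<Rightarrow> 'k::{zero,one,minus}" where
  "rel_poly u = (\<lambda>w. (if w = u then 1 else 0) - (if w = [] then 1 else 0))"

definition regular_over :: "'c set \<Rightarrow> 'c list set \<Rightarrow> bool" where
  "regular_over \<Sigma> L \<longleftrightarrow> finite \<Sigma> \<and> L \<subseteq> lists \<Sigma> \<and>
     (\<exists>(Q :: nat set) q0 \<delta> F. finite Q \<and> q0 \<in> Q \<and> (\<forall>q\<in>Q. \<forall>c\<in>\<Sigma>. \<delta> q c \<in> Q) \<and> F \<subseteq> Q \<and>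
        (\<forall>w\<in>lists \<Sigma>. w \<in> L \<longleftrightarrow> foldl \<delta> q0 w \<in> F))"

text \<open>None plays the role of the padding symbol \$.\<close>
definition A2 :: "'b set \<Rightarrow> ('b option \<times> 'b option) set" where
  "A2 A = (insert None (Some ` A) \<times> insert None (Some ` A)) - {(None, None)}"

definition padR :: "'b list \<Rightarrow> 'b list \<Rightarrow> ('b option \<times> 'b option) list" where
  "padR \<alpha> \<beta> = zip (map Some \<alpha> @ replicate (length \<beta> - length \<alpha>) None)
                   (map Some \<beta> @ replicate (length \<alpha> - length \<beta>) None)"

definition padL :: "'b list \<Rightarrow> 'b list \<Rightarrow> ('b option \<times> 'b option) list" where
  "padL \<alpha> \<beta> = zip (replicate (length \<beta> - length \<alpha>) None @ map Some \<alpha>)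
                   (replicate (length \<alpha> - length \<beta>) None @ map Some \<beta>)"

text \<open>Canonical map A+ -> S for a generating map gamma (only used on nonempty words).\<close>
definition sg_eval :: "('s \<Rightarrow> 's \<Rightarrow> 's) \<Rightarrow> (nat \<Rightarrow> 's) \<Rightarrow> nat list \<Rightarrow> 's" where
  "sg_eval mult \<gamma> \<alpha> = fold (\<lambda>j acc. mult acc (\<gamma> j)) (tl \<alpha>) (\<gamma> (hd \<alpha>))"

text \<open>Biautomatic semigroup (S, mult): some finite generating set, identified with the alphabet
  {0..<m} via an injective map gamma into S, and a regular L in A+ mapping onto S such that
  all four padded families are regular for every a in A or a = epsilon.\<close>
definition biautomatic :: "'s set \<Rightarrow> ('s \<Rightarrow> 's \<Rightarrow> 's) \<Rightarrow> bool" where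
  "biautomatic S mult \<longleftrightarrow>
    (\<exists>(m :: nat) (\<gamma> :: nat \<Rightarrow> 's) (L :: nat list set).
       inj_on \<gamma> {0..<m} \<and> \<gamma> ` {0..<m} \<subseteq> S \<and>
       L \<subseteq> lists {0..<m} - {[]} \<and> regular_over {0..<m} L \<and>
       sg_eval mult \<gamma> ` L = S \<and>
       (\<forall>a. (a = [] \<or> (\<exists>i\<in>{0..<m}. a = [i])) \<longrightarrow>
          regular_over (A2 {0..<m})
            {padR \<alpha> \<beta> | \<alpha> \<beta>. \<alpha> \<in> L \<and> \<beta> \<in> L \<and> sg_eval mult \<gamma> (\<alpha> @ a) = sg_eval mult \<gamma> \<beta>} \<and>
          regular_over (A2 {0..<m})
            {padL \<alpha> \<beta> | \<alpha> \<beta>. \<alpha> \<in> L \<and> \<beta> \<in> L \<and> sg_eval mult \<gamma> (\<alpha> @ a) = sg_eval mult \<gamma> \<beta>} \<and>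
          regular_over (A2 {0..<m})
            {padR \<alpha> \<beta> | \<alpha> \<beta>. \<alpha> \<in> L \<and> \<beta> \<in> L \<and> sg_eval mult \<gamma> (a @ \<alpha>) = sg_eval mult \<gamma> \<beta>} \<and>
          regular_over (A2 {0..<m})
            {padL \<alpha> \<beta> | \<alpha> \<beta>. \<alpha> \<in> L \<and> \<beta> \<in> L \<and> sg_eval mult \<gamma> (a @ \<alpha>) = sg_eval mult \<gamma> \<beta>}))"

end

theory Submission
  imports Defs "HOL-Library.Confluence"
begin

text \<open>Let \<open>w = u b = a u\<close> be an overlap of \<open>u\<close> with itself. Triviality of its composition \<open>a - b\<close>
  modulo \<open>w\<close> makes \<open>a\<close> and \<open>b\<close> equivalent under deletions of \<open>u\<close> among words below \<open>w\<close>. By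
  induction on \<open>|b|\<close>, deletion is confluent on those words, and as \<open>a\<close> and \<open>b\<close> are shorter
  than \<open>u\<close> they coincide. Hence deleting \<open>u\<close> is confluent on all words, and every element of
  the monoid has exactly one representative without the factor \<open>u\<close>.

  Multiplying such a word \<open>w\<close> by a letter either gives another one or completes a single \<open>u\<close>
  at the end concerned, so the multiplication relations consist of pairs that differ by a
  fixed prefix or a fixed suffix. Padded on either side, these are recognised by an automaton
  that remembers a bounded queue of letters. The empty word is not available as a
  representative, so the identity is added as an extra generator \<open>e\<close> and \<open>w\<close> is encoded as \<open>e w\<close>.\<close>

section \<open>Deletion of a factor\<close>

definition has_factor :: "'a list \<Rightarrow> 'a list \<Rightarrow> bool" where
  "has_factor u x \<longleftrightarrow> (\<exists>p q. x = p @ u @ q)"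

text \<open>Both ends of a step are confined to \<open>B\<close>: the induction on overlaps takes
  for \<open>B\<close> the words below an overlap, the final confluence result takes all
  words.\<close>

definition del_step :: "'a list \<Rightarrow> 'a list set \<Rightarrow> 'a list \<Rightarrow> 'a list \<Rightarrow> bool" where
  "del_step u B x y \<longleftrightarrow> x \<in> B \<and> y \<in> B \<and> (\<exists>p q. x = p @ u @ q \<and> y = p @ q)"

text \<open>Disjoint occurrences can be deleted in either order. Overlapping ones give
  \<open>u = d @ e = e @ b\<close>, hence \<open>d @ u = u @ b\<close>, and \<open>overlap\<close>
  makes the two results equal.\<close>

lemma del_steps_joinable:
  assumes closed: "\<And>p q. p @ u @ q \<in> B \<Longrightarrow> p @ q \<in> B"
    and overlap: "\<And>a b p q. \<lbrakk>a @ u = u @ b; length b < length u; p @ u @ b @ q \<in> B\<rbrakk> \<Longrightarrow> a = b"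
    and x: "p @ u @ q \<in> B" "p @ u @ q = p' @ u @ q'" and le: "length p \<le> length p'"
  shows "p @ q = p' @ q' \<or> (\<exists>v. del_step u B (p @ q) v \<and> del_step u B (p' @ q') v)"
proof -
  obtain d where p': "p' = p @ d" and d: "u @ q = d @ u @ q'"
    using x(2) le that[of "[]"] by (auto simp: append_eq_append_conv2)
  show ?thesis
  proof (cases "length u \<le> length d")
    case True
    then obtain d' where d': "d = u @ d'" "q = d' @ u @ q'"
      using d by (auto simp: append_eq_append_conv2)
    have "(p @ d') @ u @ q' \<in> B" "p @ u @ (d' @ q') \<in> B"
      using x closed[of p q] closed[of "p @ u @ d'" q'] by (simp_all add: p' d')
    moreover from this have "p @ d' @ q' \<in> B"
      using closed by fastforce
    ultimately have "del_step u B (p @ q) (p @ d' @ q')" "del_step u B (p' @ q') (p @ d' @ q')"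
      unfolding del_step_def by (auto simp: p' d' intro: exI[of _ "p @ d'"] exI[of _ p])
    then show ?thesis by blast
  next
    case False
    obtain e where "u = d @ e \<and> e @ q = u @ q' \<or> u @ e = d \<and> q = e @ u @ q'"
      using d unfolding append_eq_append_conv2[of u q d] by blast
    then have e: "u = d @ e" "e @ q = u @ q'" using False by auto
    obtain b where "e = u @ b \<and> b @ q = q' \<or> e @ b = u \<and> q = b @ q'"
      using e(2) unfolding append_eq_append_conv2[of e q u] by blast
    then have b: "u = e @ b" "q = b @ q'" using arg_cong[OF e(1), of length] by auto
    have "d @ u = u @ b" using b(1) e(1) by (metis append_assoc)
    moreover from this have "length b < length u"
      using False by (metis add_diff_cancel_right' add.commute length_append not_le)
    ultimately have "d = b" using overlap[of d b p q'] x(1) b by simp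
    then show ?thesis by (simp add: p' b)
  qed
qed

text \<open>Two deletions from one word are joined by at most one further step each, which is strong
  confluence.\<close>

lemma confluentp_del_step:
  assumes closed: "\<And>p q. p @ u @ q \<in> B \<Longrightarrow> p @ q \<in> B"
    and overlap: "\<And>a b p q. \<lbrakk>a @ u = u @ b; length b < length u; p @ u @ b @ q \<in> B\<rbrakk> \<Longrightarrow> a = b"
  shows "confluentp (del_step u B)"
proof (rule strong_confluentp_imp_confluentp, rule strong_confluentpI)
  fix x y z assume "del_step u B x y" "del_step u B x z"
  then obtain p q p' q' where *: "x \<in> B" "x = p @ u @ q" "y = p @ q" "x = p' @ u @ q'" "z = p' @ q'"
    unfolding del_step_def by blast
  have join: "p @ q = p' @ q' \<or> (\<exists>v. del_step u B (p @ q) v \<and> del_step u B (p' @ q') v)"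
    if "p @ u @ q \<in> B" "p @ u @ q = p' @ u @ q'" "length p \<le> length p'" for p q p' q'
    by (rule del_steps_joinable[OF _ _ that]) (erule closed, erule (2) overlap)
  have "y = z \<or> (\<exists>v. del_step u B y v \<and> del_step u B z v)"
  proof -
    have x: "p @ u @ q \<in> B" "p @ u @ q = p' @ u @ q'" "p' @ u @ q' \<in> B" using *(1,2,4) by metis+
    show ?thesis
    proof (cases "length p \<le> length p'")
      case True
      from join[OF x(1,2) this] show ?thesis unfolding *(3,5) .
    next
      case False
      then have "length p' \<le> length p" by simp
      from join[OF x(3) x(2)[symmetric] this] show ?thesis unfolding *(3,5) by metis
    qed
  qed
  then show "\<exists>v. (del_step u B)\<^sup>*\<^sup>* y v \<and> (del_step u B)\<^sup>=\<^sup>= z v" by blast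
qed

text \<open>Factor-free words are irreducible, so the common reduct supplied by confluence equals
  both of them.\<close>

lemma factor_free_equivclp_unique:
  assumes "confluentp (del_step u B)" "equivclp (del_step u B) x y"
    and x: "\<not> has_factor u x" and y: "\<not> has_factor u y"
  shows "x = y"
proof -
  obtain z where z: "(del_step u B)\<^sup>*\<^sup>* x z" "(del_step u B)\<^sup>*\<^sup>* y z"
    using assms(1,2) unfolding confluentp_eq_semiconfluentp rtranclp_conversep
    by (auto simp: semiconfluentp_equivclp rtranclp_conversep)
  have "z = w" if "(del_step u B)\<^sup>*\<^sup>* w z" "\<not> has_factor u w" for w
    using that by (cases rule: converse_rtranclpE) (auto simp: del_step_def has_factor_def)
  then show ?thesis using z x y by metis
qed

section \<open>Overlaps of a word that forms a Groebner-Shirshov basis\<close>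

lemma deglex_length: "length x < length y \<Longrightarrow> (x, y) \<in> deglex"
  by (simp add: deglex_def lenlex_conv)

lemma deglex_length_le: "(x, y) \<in> deglex \<Longrightarrow> length x \<le> length y"
  by (auto simp: deglex_def lenlex_conv)

lemma deglex_irrefl: "(x, x) \<notin> deglex"
  unfolding deglex_def by (rule lenlex_irreflexive) simp

lemma lw_rel_poly:
  assumes "u \<noteq> []"
  shows "lw (rel_poly u :: _ \<Rightarrow> 'k::field) = u"
  unfolding lw_def
proof (rule the_equality)
  show "(rel_poly u u :: 'k) \<noteq> 0 \<and> (\<forall>v. (rel_poly u v :: 'k) \<noteq> 0 \<longrightarrow> v = u \<or> (v, u) \<in> deglex)"
    using assms by (auto simp: rel_poly_def intro: deglex_length)
next
  fix w
  assume w: "(rel_poly u w :: 'k) \<noteq> 0 \<and> (\<forall>v. (rel_poly u v :: 'k) \<noteq> 0 \<longrightarrow> v = w \<or> (v, w) \<in> deglex)"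
  have "(rel_poly u u :: 'k) \<noteq> 0" using assms by (simp add: rel_poly_def)
  then have "u = w \<or> (u, w) \<in> deglex" using w by blast
  moreover have "w = u \<or> w = []" using w by (auto simp: rel_poly_def split: if_splits)
  ultimately show "w = u" using assms deglex_length_le[of u "[]"] by auto
qed

lemma wmul_rel_poly:
  "wmul a (rel_poly u) b x = ((if x = a @ u @ b then 1 else 0) - (if x = a @ b then 1 else 0) :: 'k::field)"
proof (cases "\<exists>v. x = a @ v @ b")
  case True
  then obtain v where v: "x = a @ v @ b" by blast
  have "(THE v. x = a @ v @ b) = v" using v by (intro the_equality) auto
  then show ?thesis using v by (auto simp: wmul_def rel_poly_def)
next
  case False
  then show ?thesis by (auto simp: wmul_def)
qed

text \<open>Summation over \<open>X\<close> is linear in the polynomial. It kills each term, because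
  the two words of \<open>a u b - a b\<close> lie both inside or both outside
  \<open>X\<close>.\<close>

lemma sum_combination_on_class_zero:
  fixes ts :: "('k::field \<times> 'a list \<times> ('a list \<Rightarrow> 'k) \<times> 'a list) list"
  assumes "finite X"
    and "\<And>\<alpha> a s b. (\<alpha>, a, s, b) \<in> set ts \<Longrightarrow> s = rel_poly u \<and> (a @ u @ b \<in> X \<longleftrightarrow> a @ b \<in> X)"
  shows "(\<Sum>x\<in>X. \<Sum>(\<alpha>, a, s, b)\<leftarrow>ts. \<alpha> * wmul a s b x) = 0"
  using assms(2)
proof (induction ts)
  case (Cons t ts)
  obtain \<alpha> a s b where t: "t = (\<alpha>, a, s, b)" by (cases t)
  have s: "s = rel_poly u" and X: "a @ u @ b \<in> X \<longleftrightarrow> a @ b \<in> X" using Cons.prems[of \<alpha> a s b] t by auto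
  have "(\<Sum>x\<in>X. \<alpha> * wmul a s b x) = 0"
    using assms(1) X by (simp add: s wmul_rel_poly sum_distrib_left[symmetric] sum_subtractf)
  moreover have "(\<Sum>x\<in>X. \<Sum>(\<alpha>, a, s, b)\<leftarrow>ts. \<alpha> * wmul a s b x) = 0"
    using Cons.prems by (intro Cons.IH) auto
  ultimately show ?case by (simp add: t sum.distrib)
qed simp

text \<open>If the composition of the overlap \<open>w\<close> is trivial modulo \<open>w\<close>, pairing it with the
  indicator function of an equivalence class of words below \<open>w\<close> shows that both remainders
  are equivalent below \<open>w\<close>.\<close>

lemma GSB_overlap_equivclp:
  fixes u :: "'a::{finite,linorder} list"
  assumes gsb: "GSB ({rel_poly u} :: ('a list \<Rightarrow> 'k::field) set)"
    and w: "a @ u = u @ b" and len: "length b < length u"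
  defines "B \<equiv> {x. (x, u @ b) \<in> deglex}"
  shows "equivclp (del_step u B) a b"
proof -
  let ?f = "rel_poly u :: 'a list \<Rightarrow> 'k"
  have lw: "lw ?f = u" using len by (intro lw_rel_poly) auto
  have "trivial_mod {?f} (u @ b) (\<lambda>x. wmul [] ?f b x - wmul a ?f [] x)"
    using gsb w[symmetric] len unfolding GSB_def by (simp add: lw)
  then obtain ts :: "('k \<times> 'a list \<times> ('a list \<Rightarrow> 'k) \<times> 'a list) list" where
    ts: "\<And>\<alpha> a' s b'. (\<alpha>, a', s, b') \<in> set ts \<Longrightarrow> s = ?f \<and> (a' @ u @ b', u @ b) \<in> deglex"
    and h: "(\<lambda>x. wmul [] ?f b x - wmul a ?f [] x) = (\<lambda>x. \<Sum>(\<alpha>, a, s, b) \<leftarrow> ts. \<alpha> * wmul a s b x)"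
    unfolding trivial_mod_def using lw by fastforce
  \<comment> \<open>The length bound makes \<open>X\<close> finite, and it holds for every word
    occurring in the terms of \<open>ts\<close>.\<close>
  define X where "X = {x. length x \<le> length (u @ b) \<and> equivclp (del_step u B) a x}"
  have "finite {x :: 'a list. set x \<subseteq> UNIV \<and> length x \<le> length (u @ b)}"
    by (rule finite_lists_length_le) simp
  then have finX: "finite X" by (rule finite_subset[rotated]) (auto simp: X_def)
  have X_iff: "a' @ u @ b' \<in> X \<longleftrightarrow> a' @ b' \<in> X" if "(a' @ u @ b', u @ b) \<in> deglex" for a' b'
  proof -
    have "(a' @ b', u @ b) \<in> deglex"
      using deglex_length_le[OF that] len by (intro deglex_length) auto
    then have "del_step u B (a' @ u @ b') (a' @ b')"
      using that unfolding del_step_def B_def by blast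
    then have "equivclp (del_step u B) (a' @ u @ b') (a' @ b')" by blast
    then show ?thesis
      using deglex_length_le[OF that] unfolding X_def
      by (auto intro: equivclp_trans equivclp_sym)
  qed
  have len_eq: "length a = length b" using arg_cong[OF w, of length] by simp
  have aX: "a \<in> X" by (simp add: X_def len_eq)
  have "(\<Sum>x\<in>X. wmul [] ?f b x - wmul a ?f [] x) = 0"
    using sum_combination_on_class_zero[OF finX, of ts u] ts X_iff unfolding fun_cong[OF h] by blast
  \<comment> \<open>The leading words \<open>u @ b\<close> and \<open>a @ u\<close> cancel, which
    leaves \<open>a - b\<close>. Its sum over \<open>X\<close> vanishes and \<open>a\<close> lies in
    \<open>X\<close>, so \<open>b\<close> must lie there too.\<close>
  then have "(\<Sum>x\<in>X. (if x = a then 1 else 0) - (if x = b then 1 else 0 :: 'k)) = 0"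
    using w by (simp add: wmul_rel_poly cong: if_cong)
  then have "b \<in> X" using finX aX by (simp add: sum_subtractf split: if_splits)
  then show ?thesis by (simp add: X_def)
qed

text \<open>An overlap \<open>u @ b'\<close> inside a word below \<open>u @ b\<close> has
  \<open>b'\<close> shorter than \<open>b\<close>: equal lengths would give \<open>b' = b\<close>
  and make that word \<open>u @ b\<close> itself. The induction hypothesis thus supplies the overlap
  condition for confluence below \<open>u @ b\<close>.\<close>

lemma GSB_overlap_eq:
  fixes u :: "'a::{finite,linorder} list"
  assumes gsb: "GSB ({rel_poly u} :: ('a list \<Rightarrow> 'k::field) set)"
    and "a @ u = u @ b" "length b < length u"
  shows "a = b"
  using assms(2,3)
proof (induction "length b" arbitrary: a b rule: less_induct)
  case less
  define B where "B = {x. (x, u @ b) \<in> deglex}"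
  have "confluentp (del_step u B)"
  proof (rule confluentp_del_step)
    fix p q assume "p @ u @ q \<in> B"
    then show "p @ q \<in> B"
      using less.prems(2) deglex_length_le[of "p @ u @ q" "u @ b"]
      by (auto simp: B_def intro!: deglex_length)
  next
    fix a' b' p q
    assume w': "a' @ u = u @ b'" "length b' < length u" "p @ u @ b' @ q \<in> B"
    then have le: "length p + length b' + length q \<le> length b"
      using deglex_length_le[of "p @ u @ b' @ q" "u @ b"] by (auto simp: B_def)
    have "b' \<noteq> b \<or> p \<noteq> [] \<or> q \<noteq> []"
      using w'(3) deglex_irrefl[of "u @ b"] by (auto simp: B_def)
    moreover have "b' = b" if "length b' = length b"
      \<comment> \<open>both are the suffix of \<open>u\<close> of that length\<close>
    proof -
      have "drop (length a) (a @ u) = u" "drop (length a') (a' @ u) = u" by simp_all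
      moreover have "length a = length b" "length a' = length b'"
        using arg_cong[OF w'(1), of length] arg_cong[OF less.prems(1), of length] by simp_all
      ultimately have "u = drop (length b) u @ b" "u = drop (length b) u @ b'"
        using w' less.prems that by simp_all
      then show ?thesis by (metis same_append_eq)
    qed
    ultimately have "length b' < length b" using le by (cases "length b' = length b") auto
    then show "a' = b'" using less.hyps w' by blast
  qed
  moreover have "equivclp (del_step u B) a b"
    unfolding B_def by (rule GSB_overlap_equivclp[OF gsb less.prems])
  moreover have "length a = length b" using arg_cong[OF less.prems(1), of length] by simp
  ultimately show ?case
    using less.prems(2) by (intro factor_free_equivclp_unique) (auto simp: has_factor_def)
qed

section \<open>Normal forms of the congruence\<close>

lemma pcong_append: "pcong R x x' \<Longrightarrow> pcong R y y' \<Longrightarrow> pcong R (x @ y) (x' @ y')"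
  using pcong.cong[of R x x' "[]" y] pcong.cong[of R y y' x' "[]"] by (auto intro: pcong.trans)

lemma del_step_imp_pcong: "del_step u B x y \<Longrightarrow> pcong {(u, [])} x y"
  using pcong.cong[of "{(u, [])}" u "[]"] by (auto simp: del_step_def intro: pcong.base)

text \<open>Unrestricted deletion steps are preserved by contexts, and so is the equivalence that
  they generate.\<close>

lemma pcong_imp_equivclp: "pcong {(u, [])} x y \<Longrightarrow> equivclp (del_step u UNIV) x y"
proof (induction rule: pcong.induct)
  case (base x y)
  then have "del_step u UNIV x y" by (auto simp: del_step_def intro: exI[of _ "[]"])
  then show ?case by blast
next
  case (cong x y p q)
  have step: "del_step u UNIV (p @ x @ q) (p @ y @ q)" if "del_step u UNIV x y" for x y
  proof -
    from that obtain p' q' where "x = p' @ u @ q'" "y = p' @ q'" by (auto simp: del_step_def)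
    then have "p @ x @ q = (p @ p') @ u @ (q' @ q)" "p @ y @ q = (p @ p') @ (q' @ q)" by simp_all
    then show ?thesis unfolding del_step_def by blast
  qed
  from cong.IH show ?case
    by (induction rule: equivclp_induct) (auto dest: step intro: equivclp_trans)
qed (auto intro: equivclp_sym equivclp_trans)

text \<open>With \<open>B = UNIV\<close> the overlap condition is exactly
  \<open>GSB_overlap_eq\<close>. This is the only form in which the basis hypothesis enters the
  automata part.\<close>

lemma GSB_pcong_unique:
  fixes u :: "'a::{finite,linorder} list"
  assumes "GSB ({rel_poly u} :: ('a list \<Rightarrow> 'k::field) set)" "pcong {(u, [])} x y"
    and "\<not> has_factor u x" "\<not> has_factor u y"
  shows "x = y"
proof (rule factor_free_equivclp_unique)
  show "confluentp (del_step u UNIV)"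
    by (rule confluentp_del_step) (auto intro: GSB_overlap_eq[OF assms(1)])
qed (use assms pcong_imp_equivclp in auto)

text \<open>Deleting an occurrence of the nonempty word \<open>u\<close> shortens the word, so the
  process ends.\<close>

lemma factor_free_representative:
  assumes "u \<noteq> []"
  shows "\<exists>y. pcong {(u, [])} x y \<and> \<not> has_factor u y"
proof (induction "length x" arbitrary: x rule: less_induct)
  case less
  show ?case
  proof (cases "has_factor u x")
    case True
    then obtain p q where x: "x = p @ u @ q" by (auto simp: has_factor_def)
    then have "pcong {(u, [])} x (p @ q)" "length (p @ q) < length x"
      using assms del_step_imp_pcong[of u UNIV x "p @ q"] by (auto simp: del_step_def)
    then show ?thesis using less by (meson pcong.trans)
  qed (auto intro: pcong.refl)
qed

text \<open>As \<open>w\<close> is factor-free, an occurrence of \<open>u\<close> in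
  \<open>w @ [c]\<close> has to be a suffix. Deleting it leaves a prefix of \<open>w\<close>, which
  is already a normal form, so one deletion suffices.\<close>

lemma pcong_snoc_iff:
  assumes unique: "\<And>x y. \<lbrakk>pcong {(u, [])} x y; \<not> has_factor u x; \<not> has_factor u y\<rbrakk> \<Longrightarrow> x = y"
    and "u \<noteq> []" and w: "\<not> has_factor u w" and v: "\<not> has_factor u v"
  shows "pcong {(u, [])} (w @ [c]) v \<longleftrightarrow> v = w @ [c] \<or> (\<exists>s. u = s @ [c] \<and> w = v @ s)"
proof
  assume cong: "pcong {(u, [])} (w @ [c]) v"
  show "v = w @ [c] \<or> (\<exists>s. u = s @ [c] \<and> w = v @ s)"
  proof (cases "has_factor u (w @ [c])")
    case True
    then obtain p q where pq: "w @ [c] = p @ u @ q" by (auto simp: has_factor_def)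
    have "q = []" using pq w by (cases q rule: rev_cases) (auto simp: has_factor_def)
    moreover obtain s d where "u = s @ [d]" using \<open>u \<noteq> []\<close> by (cases u rule: rev_cases) auto
    ultimately have s: "u = s @ [c]" "w = p @ s" using pq by simp_all
    have "\<not> has_factor u p"
    proof
      assume "has_factor u p"
      then obtain p' q' where "p = p' @ u @ q'" by (auto simp: has_factor_def)
      then have "w = p' @ u @ (q' @ s)" using s by simp
      then show False using w unfolding has_factor_def by blast
    qed
    moreover have "pcong {(u, [])} (w @ [c]) p"
      using s pcong.cong[of "{(u, [])}" u "[]" p "[]"] by (auto intro: pcong.base)
    ultimately have "p = v" using unique v cong by (meson pcong.sym pcong.trans)
    then show ?thesis using s by blast
  qed (use unique cong v in blast)
next
  assume "v = w @ [c] \<or> (\<exists>s. u = s @ [c] \<and> w = v @ s)"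
  then show "pcong {(u, [])} (w @ [c]) v"
    using pcong.cong[OF pcong.base[of u "[]" "{(u, [])}"], of v "[]"] by (auto intro: pcong.refl)
qed

text \<open>Mirror image of \<open>pcong_snoc_iff\<close>: an occurrence of \<open>u\<close> in
  \<open>c # w\<close> has to be a prefix.\<close>

lemma pcong_Cons_iff:
  assumes unique: "\<And>x y. \<lbrakk>pcong {(u, [])} x y; \<not> has_factor u x; \<not> has_factor u y\<rbrakk> \<Longrightarrow> x = y"
    and "u \<noteq> []" and w: "\<not> has_factor u w" and v: "\<not> has_factor u v"
  shows "pcong {(u, [])} (c # w) v \<longleftrightarrow> v = c # w \<or> (\<exists>s. u = c # s \<and> w = s @ v)"
proof
  assume cong: "pcong {(u, [])} (c # w) v"
  show "v = c # w \<or> (\<exists>s. u = c # s \<and> w = s @ v)"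
  proof (cases "has_factor u (c # w)")
    case True
    then obtain p q where pq: "c # w = p @ u @ q" by (auto simp: has_factor_def)
    have "p = []" using pq w by (cases p) (auto simp: has_factor_def)
    moreover obtain d s where "u = d # s" using \<open>u \<noteq> []\<close> by (cases u) auto
    ultimately have s: "u = c # s" "w = s @ q" using pq by simp_all
    have "\<not> has_factor u q"
    proof
      assume "has_factor u q"
      then obtain p' q' where "q = p' @ u @ q'" by (auto simp: has_factor_def)
      then have "w = (s @ p') @ u @ q'" using s by simp
      then show False using w unfolding has_factor_def by blast
    qed
    moreover have "pcong {(u, [])} (c # w) q"
      using s pcong.cong[of "{(u, [])}" u "[]" "[]" q] by (auto intro: pcong.base)
    ultimately have "q = v" using unique v cong by (meson pcong.sym pcong.trans)
    then show ?thesis using s by blast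
  qed (use unique cong v in blast)
next
  assume "v = c # w \<or> (\<exists>s. u = c # s \<and> w = s @ v)"
  then show "pcong {(u, [])} (c # w) v"
    using pcong.cong[OF pcong.base[of u "[]" "{(u, [])}"], of "[]" v] by (auto intro: pcong.refl)
qed

section \<open>Closure properties of regular languages\<close>

text \<open>A Myhill-Nerode criterion: a finite-valued \<open>f\<close> that determines the residual
  language of every prefix. The automaton has the residuals \<open>D x\<close> as states, coded by
  natural numbers through \<open>i\<close>.\<close>

lemma regular_overI:
  assumes fin: "finite \<Sigma>" and L: "L \<subseteq> lists \<Sigma>"
    and finf: "finite (f ` lists \<Sigma>)"
    and f: "\<And>x y z. \<lbrakk>x \<in> lists \<Sigma>; y \<in> lists \<Sigma>; z \<in> lists \<Sigma>; f x = f y; x @ z \<in> L\<rbrakk> \<Longrightarrow> y @ z \<in> L"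
  shows "regular_over \<Sigma> L"
proof -
  define D where "D x = {z \<in> lists \<Sigma>. x @ z \<in> L}" for x
  have D_eq: "D x = D y" if "x \<in> lists \<Sigma>" "y \<in> lists \<Sigma>" "f x = f y" for x y
    using f[of x y] f[of y x] that by (auto simp: D_def)
  let ?\<D> = "D ` lists \<Sigma>"
  \<comment> \<open>Since \<open>D x\<close> depends only on \<open>f x\<close>, choosing a
    representative for each value of \<open>f\<close> exhibits the residuals as an image of a finite
    set.\<close>
  define r where "r v = D (SOME y. y \<in> lists \<Sigma> \<and> f y = v)" for v
  have r: "D x = r (f x)" if "x \<in> lists \<Sigma>" for x
  proof -
    let ?y = "SOME y. y \<in> lists \<Sigma> \<and> f y = f x"
    have "?y \<in> lists \<Sigma> \<and> f ?y = f x" by (rule someI[of _ x]) (use that in simp)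
    then show ?thesis unfolding r_def using that by (intro D_eq) auto
  qed
  have "?\<D> = r ` f ` lists \<Sigma>" unfolding image_image using r by (rule image_cong[OF HOL.refl])
  then have fin\<D>: "finite ?\<D>" using finf by simp
  then obtain i :: "'a list set \<Rightarrow> nat" where i: "inj_on i ?\<D>"
    using finite_imp_inj_to_nat_seg by blast
  \<comment> \<open>A transition decodes the state to a residual and passes to its left quotient by
    \<open>c\<close>.\<close>
  define \<delta> where "\<delta> q c = i {z \<in> lists \<Sigma>. c # z \<in> the_inv_into ?\<D> i q}" for q c
  have step: "\<delta> (i (D x)) c = i (D (x @ [c]))" if "x \<in> lists \<Sigma>" "c \<in> \<Sigma>" for x c
  proof -
    have "the_inv_into ?\<D> i (i (D x)) = D x" using i that by (simp add: the_inv_into_f_f)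
    moreover have "{z \<in> lists \<Sigma>. c # z \<in> D x} = D (x @ [c])" using that by (auto simp: D_def)
    ultimately show ?thesis by (simp add: \<delta>_def)
  qed
  have run: "foldl \<delta> (i (D [])) w = i (D w)" if "w \<in> lists \<Sigma>" for w
    using that by (induction w rule: rev_induct) (auto simp: step)
  let ?F = "i ` D ` {w \<in> lists \<Sigma>. w \<in> L}"
  have "w \<in> L \<longleftrightarrow> foldl \<delta> (i (D [])) w \<in> ?F" if w: "w \<in> lists \<Sigma>" for w
  proof
    assume "foldl \<delta> (i (D [])) w \<in> ?F"
    then obtain v where "v \<in> lists \<Sigma>" "v \<in> L" "i (D w) = i (D v)" using run w by auto
    then have "D w = D v" "[] \<in> D v" using i w by (auto simp: inj_on_def D_def)
    then have "[] \<in> D w" by simp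
    then show "w \<in> L" by (simp add: D_def)
  qed (use run w in auto)
  moreover have "\<forall>q\<in>i ` ?\<D>. \<forall>c\<in>\<Sigma>. \<delta> q c \<in> i ` ?\<D>" by (auto simp: step)
  moreover have "i (D []) \<in> i ` ?\<D>" by auto
  moreover have "?F \<subseteq> i ` ?\<D>" by auto
  ultimately show ?thesis
    unfolding regular_over_def using fin L fin\<D>
    by (intro conjI exI[of _ "i ` ?\<D>"] exI[of _ "i (D [])"] exI[of _ \<delta>] exI[of _ ?F]) auto
qed

text \<open>Here \<open>f\<close> is the state reached after a word. Together with
  \<open>regular_overI\<close> this reduces closure properties to finding a finite-valued
  invariant.\<close>

lemma regular_overE:
  assumes "regular_over \<Sigma> L"
  obtains f :: "'c list \<Rightarrow> nat" where "finite \<Sigma>" "L \<subseteq> lists \<Sigma>" "finite (f ` lists \<Sigma>)"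
    "\<And>x y z. \<lbrakk>x \<in> lists \<Sigma>; y \<in> lists \<Sigma>; z \<in> lists \<Sigma>; f x = f y\<rbrakk> \<Longrightarrow> x @ z \<in> L \<longleftrightarrow> y @ z \<in> L"
proof -
  obtain Q :: "nat set" and q0 \<delta> F where *: "finite Q" "q0 \<in> Q" "\<forall>q\<in>Q. \<forall>c\<in>\<Sigma>. \<delta> q c \<in> Q"
    "\<forall>w\<in>lists \<Sigma>. w \<in> L \<longleftrightarrow> foldl \<delta> q0 w \<in> F" and fin: "finite \<Sigma>" "L \<subseteq> lists \<Sigma>"
    using assms unfolding regular_over_def by blast
  have "foldl \<delta> q0 w \<in> Q" if "w \<in> lists \<Sigma>" for w
    using that by (induction w rule: rev_induct) (use * in auto)
  then have "finite (foldl \<delta> q0 ` lists \<Sigma>)" using \<open>finite Q\<close> by (meson finite_subset image_subsetI)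
  moreover have "x @ z \<in> L \<longleftrightarrow> y @ z \<in> L"
    if "x \<in> lists \<Sigma>" "y \<in> lists \<Sigma>" "z \<in> lists \<Sigma>" "foldl \<delta> q0 x = foldl \<delta> q0 y" for x y z
  proof -
    have "x @ z \<in> lists \<Sigma>" "y @ z \<in> lists \<Sigma>" using that by auto
    then show ?thesis using *(4) that(4) by (metis foldl_append)
  qed
  ultimately show ?thesis using that fin by blast
qed

lemma regular_over_finite: "regular_over \<Sigma> L \<Longrightarrow> finite \<Sigma>"
  and regular_over_subset: "regular_over \<Sigma> L \<Longrightarrow> L \<subseteq> lists \<Sigma>"
  by (simp_all add: regular_over_def)

text \<open>Product construction, with the pair of both invariants.\<close>

lemma regular_over_boolean:
  assumes K: "regular_over \<Sigma> K" and L: "regular_over \<Sigma> L"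
    and M: "M \<subseteq> lists \<Sigma>" "\<And>w. w \<in> lists \<Sigma> \<Longrightarrow> w \<in> M \<longleftrightarrow> P (w \<in> K) (w \<in> L)"
  shows "regular_over \<Sigma> M"
proof -
  from K obtain f :: "'a list \<Rightarrow> nat" where f: "finite \<Sigma>" "finite (f ` lists \<Sigma>)"
    "\<And>x y z. \<lbrakk>x \<in> lists \<Sigma>; y \<in> lists \<Sigma>; z \<in> lists \<Sigma>; f x = f y\<rbrakk> \<Longrightarrow> x @ z \<in> K \<longleftrightarrow> y @ z \<in> K"
    by (rule regular_overE) blast
  from L obtain g :: "'a list \<Rightarrow> nat" where g: "finite (g ` lists \<Sigma>)"
    "\<And>x y z. \<lbrakk>x \<in> lists \<Sigma>; y \<in> lists \<Sigma>; z \<in> lists \<Sigma>; g x = g y\<rbrakk> \<Longrightarrow> x @ z \<in> L \<longleftrightarrow> y @ z \<in> L"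
    by (rule regular_overE) blast
  show ?thesis
  proof (rule regular_overI)
    show "finite ((\<lambda>w. (f w, g w)) ` lists \<Sigma>)"
      by (rule finite_subset[OF _ finite_cartesian_product[OF f(2) g(1)]]) auto
    fix x y z assume *: "x \<in> lists \<Sigma>" "y \<in> lists \<Sigma>" "z \<in> lists \<Sigma>" "(f x, g x) = (f y, g y)" "x @ z \<in> M"
    then have "x @ z \<in> lists \<Sigma>" "y @ z \<in> lists \<Sigma>" by auto
    then show "y @ z \<in> M" using f(3)[OF *(1-3)] g(2)[OF *(1-3)] * M(2) by auto
  qed (use f M in auto)
qed

lemma regular_over_Un: "regular_over \<Sigma> K \<Longrightarrow> regular_over \<Sigma> L \<Longrightarrow> regular_over \<Sigma> (K \<union> L)"
  by (rule regular_over_boolean[where P = "(\<or>)"]) (auto dest: regular_over_subset)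

lemma regular_over_Int: "regular_over \<Sigma> K \<Longrightarrow> regular_over \<Sigma> L \<Longrightarrow> regular_over \<Sigma> (K \<inter> L)"
  by (rule regular_over_boolean[where P = "(\<and>)"]) (auto dest: regular_over_subset)

text \<open>A subset construction: \<open>s x\<close> collects the states from which reading
  \<open>rev x\<close> leads to acceptance.\<close>

lemma regular_over_rev:
  assumes "regular_over \<Sigma> L"
  shows "regular_over \<Sigma> (rev ` L)"
proof -
  from assms(1) obtain f :: "'a list \<Rightarrow> nat" where f: "finite \<Sigma>" "L \<subseteq> lists \<Sigma>" "finite (f ` lists \<Sigma>)"
    "\<And>x y z. \<lbrakk>x \<in> lists \<Sigma>; y \<in> lists \<Sigma>; z \<in> lists \<Sigma>; f x = f y\<rbrakk> \<Longrightarrow> x @ z \<in> L \<longleftrightarrow> y @ z \<in> L"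
    by (rule regular_overE) blast
  have rev_iff: "x \<in> rev ` L \<longleftrightarrow> rev x \<in> L" for x by (metis imageE image_eqI rev_rev_ident)
  define s where "s x = f ` {v \<in> lists \<Sigma>. v @ rev x \<in> L}" for x
  show ?thesis
  proof (rule regular_overI[where f = s])
    show "rev ` L \<subseteq> lists \<Sigma>" using f(2) by auto
    show "finite (s ` lists \<Sigma>)"
      by (rule finite_subset[OF _ finite_Pow_iff[THEN iffD2, OF f(3)]]) (auto simp: s_def)
    fix x y z assume *: "x \<in> lists \<Sigma>" "y \<in> lists \<Sigma>" "z \<in> lists \<Sigma>" "s x = s y" "x @ z \<in> rev ` L"
    then have "f (rev z) \<in> s x" by (auto simp: s_def rev_iff lists_eq_set)
    then obtain v where v: "v \<in> lists \<Sigma>" "v @ rev y \<in> L" "f (rev z) = f v" using *(4) by (auto simp: s_def)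
    have "rev z @ rev y \<in> L"
      using f(4)[of "rev z" v "rev y"] v * by (simp add: lists_eq_set)
    then show "y @ z \<in> rev ` L" by (simp add: rev_iff)
  qed (rule f(1))
qed

text \<open>The invariant has three kinds of values: \<open>None\<close> before any input,
  \<open>Some None\<close> after a wrong first letter, and otherwise the state of \<open>L\<close>
  on the tail.\<close>

lemma regular_over_Cons:
  assumes "regular_over \<Sigma> L" and c: "c \<in> \<Sigma>"
  shows "regular_over \<Sigma> ((#) c ` L)"
proof -
  from assms(1) obtain f :: "'a list \<Rightarrow> nat" where f: "finite \<Sigma>" "L \<subseteq> lists \<Sigma>" "finite (f ` lists \<Sigma>)"
    "\<And>x y z. \<lbrakk>x \<in> lists \<Sigma>; y \<in> lists \<Sigma>; z \<in> lists \<Sigma>; f x = f y\<rbrakk> \<Longrightarrow> x @ z \<in> L \<longleftrightarrow> y @ z \<in> L"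
    by (rule regular_overE) blast
  define s where "s x = (case x of [] \<Rightarrow> None | d # x' \<Rightarrow> Some (if d = c then Some (f x') else None))" for x
  show ?thesis
  proof (rule regular_overI[where f = s])
    have "s x \<in> {None, Some None} \<union> (Some \<circ> Some) ` f ` lists \<Sigma>" if "x \<in> lists \<Sigma>" for x
    proof (cases x)
      case (Cons d x')
      then have "x' \<in> lists \<Sigma>" using that by simp
      then show ?thesis using Cons by (simp add: s_def)
    qed (simp add: s_def)
    then have "s ` lists \<Sigma> \<subseteq> {None, Some None} \<union> (Some \<circ> Some) ` f ` lists \<Sigma>" by (rule image_subsetI)
    then show "finite (s ` lists \<Sigma>)" by (rule finite_subset) (use f(3) in simp)
    show "(#) c ` L \<subseteq> lists \<Sigma>" using f(2) c by (intro image_subsetI) auto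
    fix x y z assume *: "x \<in> lists \<Sigma>" "y \<in> lists \<Sigma>" "z \<in> lists \<Sigma>" "s x = s y" "x @ z \<in> (#) c ` L"
    show "y @ z \<in> (#) c ` L"
    proof (cases x)
      case Nil
      then have "y = []" using *(4) by (simp add: s_def split: list.splits)
      then show ?thesis using Nil *(5) by simp
    next
      case (Cons d x')
      then have x': "d = c" "x' @ z \<in> L" using *(5) by auto
      then obtain y' where y': "y = c # y'" "f x' = f y'"
        using *(4) Cons by (auto simp: s_def split: list.splits if_splits)
      then have "y' @ z \<in> L" using f(4)[of x' y' z] x' Cons *(1-3) by simp
      then show ?thesis using y' by simp
    qed
  qed (rule f(1))
qed

lemma regular_over_append_left:
  assumes "regular_over \<Sigma> L" and "v \<in> lists \<Sigma>"
  shows "regular_over \<Sigma> ((@) v ` L)"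
  using assms(2)
proof (induction v)
  case (Cons c v)
  then have "regular_over \<Sigma> ((#) c ` (@) v ` L)" by (intro regular_over_Cons) auto
  then show ?case by (simp add: image_image)
qed (use assms(1) in simp)

lemma regular_over_append_right:
  assumes "regular_over \<Sigma> L" and "v \<in> lists \<Sigma>"
  shows "regular_over \<Sigma> ((\<lambda>w. w @ v) ` L)"
proof -
  have "regular_over \<Sigma> (rev ` (@) (rev v) ` rev ` L)"
    using assms by (intro regular_over_rev regular_over_append_left) (auto simp: lists_eq_set)
  then show ?thesis by (simp add: image_image)
qed

lemma regular_over_map:
  assumes "regular_over \<Sigma> L" and h: "inj_on h \<Sigma>" "h ` \<Sigma> \<subseteq> \<Gamma>" and \<Gamma>: "finite \<Gamma>"
  shows "regular_over \<Gamma> (map h ` L)"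
proof -
  from assms(1) obtain f :: "'a list \<Rightarrow> nat" where f: "finite \<Sigma>" "L \<subseteq> lists \<Sigma>" "finite (f ` lists \<Sigma>)"
    "\<And>x y z. \<lbrakk>x \<in> lists \<Sigma>; y \<in> lists \<Sigma>; z \<in> lists \<Sigma>; f x = f y\<rbrakk> \<Longrightarrow> x @ z \<in> L \<longleftrightarrow> y @ z \<in> L"
    by (rule regular_overE) blast
  define k where "k = the_inv_into \<Sigma> h"
  have hk: "map h (map k w) = w" "map k w \<in> lists \<Sigma>" if "w \<in> lists (h ` \<Sigma>)" for w
    using that h(1) by (induction w) (auto simp: k_def the_inv_into_f_f)
  have kh: "map k (map h w) = w" if "w \<in> lists \<Sigma>" for w
    using that h(1) by (induction w) (auto simp: k_def the_inv_into_f_f)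
  have mem: "w \<in> map h ` L \<longleftrightarrow> w \<in> lists (h ` \<Sigma>) \<and> map k w \<in> L" for w
  proof
    assume "w \<in> map h ` L"
    then obtain v where "v \<in> L" "w = map h v" by blast
    then show "w \<in> lists (h ` \<Sigma>) \<and> map k w \<in> L" using kh[of v] f(2) by (auto simp: lists_eq_set)
  qed (use hk in \<open>metis imageI\<close>)
  define s where "s w = (if w \<in> lists (h ` \<Sigma>) then Some (f (map k w)) else None)" for w
  show ?thesis
  proof (rule regular_overI[where f = s])
    have "map h w \<in> lists \<Gamma>" if "w \<in> lists \<Sigma>" for w
      using that h(2) by (simp add: lists_eq_set) blast
    then show "map h ` L \<subseteq> lists \<Gamma>" using f(2) by blast
    have "s w \<in> insert None (Some ` f ` lists \<Sigma>)" for w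
      using hk(2)[of w] unfolding s_def by (cases "w \<in> lists (h ` \<Sigma>)") simp_all
    then have "s ` lists \<Gamma> \<subseteq> insert None (Some ` f ` lists \<Sigma>)" by (rule image_subsetI)
    then show "finite (s ` lists \<Gamma>)" by (rule finite_subset) (use f(3) in simp)
    fix x y z assume "s x = s y" "x @ z \<in> map h ` L"
    then show "y @ z \<in> map h ` L"
      using f(4)[of "map k x" "map k y" "map k z"] hk(2)[of x] hk(2)[of y] hk(2)[of z]
      by (auto simp: mem s_def split: if_splits)
  qed (rule \<Gamma>)
qed

text \<open>Closure under inverse homomorphisms. Its use is to impose a condition on one track of a
  padded pair, the padding being mapped to the empty word.\<close>

lemma regular_over_concat_map_vimage:
  assumes "regular_over \<Sigma> L" and \<phi>: "\<And>c. c \<in> \<Gamma> \<Longrightarrow> \<phi> c \<in> lists \<Sigma>" and \<Gamma>: "finite \<Gamma>"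
  shows "regular_over \<Gamma> {w \<in> lists \<Gamma>. concat (map \<phi> w) \<in> L}"
proof -
  from assms(1) obtain f :: "'a list \<Rightarrow> nat" where f: "finite \<Sigma>" "L \<subseteq> lists \<Sigma>" "finite (f ` lists \<Sigma>)"
    "\<And>x y z. \<lbrakk>x \<in> lists \<Sigma>; y \<in> lists \<Sigma>; z \<in> lists \<Sigma>; f x = f y\<rbrakk> \<Longrightarrow> x @ z \<in> L \<longleftrightarrow> y @ z \<in> L"
    by (rule regular_overE) blast
  have mem: "concat (map \<phi> w) \<in> lists \<Sigma>" if "w \<in> lists \<Gamma>" for w
    using that by (induction w) (use \<phi> in auto)
  show ?thesis
  proof (rule regular_overI[where f = "\<lambda>w. f (concat (map \<phi> w))"])
    have "(\<lambda>w. f (concat (map \<phi> w))) ` lists \<Gamma> \<subseteq> f ` lists \<Sigma>" using mem by blast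
    then show "finite ((\<lambda>w. f (concat (map \<phi> w))) ` lists \<Gamma>)" using f(3) finite_subset by blast
    fix x y z assume *: "x \<in> lists \<Gamma>" "y \<in> lists \<Gamma>" "z \<in> lists \<Gamma>" "f (concat (map \<phi> x)) = f (concat (map \<phi> y))"
      "x @ z \<in> {w \<in> lists \<Gamma>. concat (map \<phi> w) \<in> L}"
    then show "y @ z \<in> {w \<in> lists \<Gamma>. concat (map \<phi> w) \<in> L}"
      using f(4)[OF mem[OF *(1)] mem[OF *(2)] mem[OF *(3)]] by auto
  qed (use \<Gamma> in auto)
qed

section \<open>Words avoiding a factor\<close>

lemma has_factor_append:
  "has_factor u (x @ y) \<longleftrightarrow> has_factor u x \<or> has_factor u y \<or>
     (\<exists>q z. y = q @ z \<and> (\<exists>p v. u = p @ q \<and> x = v @ p))" (is "_ \<longleftrightarrow> ?R")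
proof
  assume "has_factor u (x @ y)"
  then obtain v z where vz: "x @ y = v @ u @ z" by (auto simp: has_factor_def)
  then show ?R
    unfolding has_factor_def append_eq_append_conv2[of x y] by (auto simp: append_eq_append_conv2)
       (metis append_Nil2 append_Nil append_assoc)+
next
  assume ?R
  then show "has_factor u (x @ y)"
    unfolding has_factor_def by (metis append_assoc)
qed

text \<open>It suffices to remember whether \<open>u\<close> has occurred and which suffixes
  \<open>q\<close> of \<open>u\<close> would complete an occurrence already begun. The fixed
  \<open>x\<close> and \<open>y\<close> are the words that a multiplication puts around
  \<open>w\<close>.\<close>

lemma regular_over_factor_free:
  fixes u x y :: "'a::finite list"
  shows "regular_over UNIV {w. \<not> has_factor u (x @ w @ y)}"
proof (rule regular_overI)
  define s where "s w = (has_factor u (x @ w), {q. \<exists>p v. u = p @ q \<and> x @ w = v @ p})" for w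
  have "{q. \<exists>p. u = p @ q} \<subseteq> (\<lambda>i. drop i u) ` {..length u}"
  proof
    fix q assume "q \<in> {q. \<exists>p. u = p @ q}"
    then obtain p where "u = p @ q" by blast
    then show "q \<in> (\<lambda>i. drop i u) ` {..length u}" by (intro image_eqI[of _ _ "length p"]) auto
  qed
  then have fin: "finite {q. \<exists>p. u = p @ q}" using finite_subset by blast
  have "s ` lists UNIV \<subseteq> UNIV \<times> Pow {q. \<exists>p. u = p @ q}" by (auto simp: s_def)
  moreover have "finite ((UNIV :: bool set) \<times> Pow {q. \<exists>p. u = p @ q})" using fin by simp
  ultimately show "finite (s ` lists UNIV)" by (rule finite_subset)
  fix w w' z assume "s w = s w'"
  then have fw: "has_factor u (x @ w) \<longleftrightarrow> has_factor u (x @ w')"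
    and "{q. \<exists>p v. u = p @ q \<and> x @ w = v @ p} = {q. \<exists>p v. u = p @ q \<and> x @ w' = v @ p}"
    unfolding s_def by (rule Pair_inject, simp)+
  from this(2) have sw: "(\<exists>p v. u = p @ q \<and> x @ w = v @ p) \<longleftrightarrow> (\<exists>p v. u = p @ q \<and> x @ w' = v @ p)" for q
    by (simp only: set_eq_iff mem_Collect_eq)
  have "has_factor u ((x @ w) @ z @ y) \<longleftrightarrow> has_factor u ((x @ w') @ z @ y)"
    unfolding has_factor_append[of u "x @ w"] has_factor_append[of u "x @ w'"] by (simp only: fw sw)
  moreover assume "w @ z \<in> {w. \<not> has_factor u (x @ w @ y)}"
  ultimately show "w' @ z \<in> {w. \<not> has_factor u (x @ w @ y)}" by simp
qed auto

section \<open>Padded pairs of words\<close>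

lemma padR_simps [simp]:
  "padR [] [] = []" "padR (c # \<alpha>) (d # \<beta>) = (Some c, Some d) # padR \<alpha> \<beta>"
  "padR (c # \<alpha>) [] = (Some c, None) # padR \<alpha> []" "padR [] (d # \<beta>) = (None, Some d) # padR [] \<beta>"
  by (simp_all add: padR_def)

text \<open>Facts about left padding are obtained from those about right padding through this
  identity.\<close>

lemma rev_padR_rev: "rev (padR (rev \<alpha>) (rev \<beta>)) = padL \<alpha> \<beta>"
  unfolding padR_def padL_def by (subst zip_rev[symmetric]) (auto simp: rev_map)

lemma padR_swap: "map prod.swap (padR \<alpha> \<beta>) = padR \<beta> \<alpha>"
  by (simp add: padR_def zip_commute[of "map Some \<beta> @ _"] prod.swap_def split_def)

lemma padL_swap: "map prod.swap (padL \<alpha> \<beta>) = padL \<beta> \<alpha>"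
  by (simp add: rev_padR_rev[symmetric] rev_map[symmetric] padR_swap)

lemma padR_append_same: "padR (\<alpha> @ x) (\<alpha> @ y) = map (\<lambda>c. (Some c, Some c)) \<alpha> @ padR x y"
  by (induction \<alpha>) simp_all

lemma padR_in_lists: "\<alpha> \<in> lists A \<Longrightarrow> \<beta> \<in> lists A \<Longrightarrow> padR \<alpha> \<beta> \<in> lists (A2 A)"
proof (induction \<alpha> arbitrary: \<beta>)
  case Nil
  then show ?case by (induction \<beta>) (auto simp: A2_def)
next
  case (Cons c \<alpha>)
  then show ?case by (cases \<beta>) (auto simp: A2_def)
qed

lemma finite_A2: "finite A \<Longrightarrow> finite (A2 A)"
  by (simp add: A2_def)

text \<open>A word over pairs of letters is \<open>padR (x @ \<alpha>) \<alpha>\<close> iff the first track is the second one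
  delayed by \<open>x\<close>. The state is the queue of letters that the first track still has to read,
  and \<open>None\<close> is the dead state; a queue shorter than \<open>k = length x\<close> means that
  the second track has ended.\<close>

fun queue_step :: "nat \<Rightarrow> 'b list option \<Rightarrow> 'b option \<times> 'b option \<Rightarrow> 'b list option" where
  "queue_step k (Some (c # q)) (Some c', Some d) =
     (if c' = c \<and> length (c # q) = k then Some (q @ [d]) else None)"
| "queue_step k (Some (c # q)) (Some c', None) = (if c' = c then Some q else None)"
| "queue_step k _ _ = None"

lemma foldl_queue_step_None: "foldl (queue_step k) None W = None"
  by (induction W) simp_all

text \<open>A queue shorter than \<open>k\<close> can only be emptied, so the rest of the input has
  to spell it out against padding.\<close>

lemma foldl_queue_step_short:
  assumes "length q < k"
  shows "foldl (queue_step k) (Some q) W = Some [] \<longleftrightarrow> W = padR q []"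
  using assms
proof (induction W arbitrary: q)
  case Nil
  then show ?case by (cases q) auto
next
  case (Cons e W)
  obtain e1 e2 where e: "e = (e1, e2)" by (cases e)
  show ?case
    using Cons by (cases q; cases e1; cases e2) (auto simp: e foldl_queue_step_None)
qed

text \<open>Induction over arbitrary full queues: the pair of \<open>c\<close> and \<open>d\<close>
  turns \<open>c # q'\<close> into the full queue \<open>q' @ [d]\<close>, whereas padding opposite
  \<open>c\<close> leaves the short queue \<open>q'\<close> to be emptied.\<close>

lemma foldl_queue_step:
  assumes "length q = k" "q \<noteq> []"
  shows "foldl (queue_step k) (Some q) W = Some [] \<longleftrightarrow> (\<exists>\<alpha>. W = padR (q @ \<alpha>) \<alpha>)"
  using assms
proof (induction W arbitrary: q)
  case Nil
  have "[] \<noteq> padR (q @ \<alpha>) \<alpha>" for \<alpha> using Nil by (cases q; cases \<alpha>) auto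
  then show ?case using Nil by simp
next
  case (Cons e W)
  obtain c q' where q: "q = c # q'" using Cons.prems by (cases q) auto
  have split: "(\<exists>\<alpha>. e # W = padR (q @ \<alpha>) \<alpha>) \<longleftrightarrow>
     (e = (Some c, None) \<and> W = padR q' []) \<or> (\<exists>d. e = (Some c, Some d) \<and> (\<exists>\<alpha>. W = padR ((q' @ [d]) @ \<alpha>) \<alpha>))"
    (is "?L \<longleftrightarrow> ?R")
  proof
    assume ?L
    then obtain \<alpha> where "e # W = padR (q @ \<alpha>) \<alpha>" by blast
    then show ?R by (cases \<alpha>) (auto simp: q)
  next
    assume ?R
    then show ?L
    proof (elim disjE exE conjE)
      assume "e = (Some c, None)" "W = padR q' []"
      then show ?L by (intro exI[of _ "[]"]) (simp add: q)
    next
      fix d \<alpha> assume "e = (Some c, Some d)" "W = padR ((q' @ [d]) @ \<alpha>) \<alpha>"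
      then show ?L by (intro exI[of _ "d # \<alpha>"]) (simp add: q)
    qed
  qed
  obtain e1 e2 where e: "e = (e1, e2)" by (cases e)
  show ?case
    unfolding split using Cons q foldl_queue_step_short[of q' k W]
    by (cases e1; cases e2) (auto simp: e foldl_queue_step_None)
qed

lemma padR_in_listsD: "padR \<alpha> \<beta> \<in> lists (A2 A) \<Longrightarrow> \<alpha> \<in> lists A \<and> \<beta> \<in> lists A"
proof (induction \<alpha> arbitrary: \<beta>)
  case Nil
  then show ?case by (induction \<beta>) (auto simp: A2_def)
next
  case (Cons c \<alpha>)
  show ?case
  proof (cases \<beta>)
    case Nil
    then show ?thesis using Cons.IH[of "[]"] Cons.prems by (auto simp: A2_def)
  next
    case (Cons d \<beta>')
    then show ?thesis using Cons.IH[of \<beta>'] Cons.prems by (auto simp: A2_def)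
  qed
qed

text \<open>The queue never exceeds the length of \<open>x\<close> and holds letters of the finite
  set \<open>A\<close>, so it serves as a finite-valued invariant.\<close>

lemma regular_over_padR_delay:
  assumes x: "x \<in> lists A" "x \<noteq> []" and A: "finite A"
  shows "regular_over (A2 A) {padR (x @ \<alpha>) \<alpha> | \<alpha>. \<alpha> \<in> lists A}"
proof (rule regular_overI)
  let ?k = "length x"
  let ?s = "foldl (queue_step ?k) (Some x)"
  let ?Q = "insert None (Some ` {q. set q \<subseteq> A \<and> length q \<le> ?k})"
  have step: "queue_step ?k q e \<in> ?Q" if "q \<in> ?Q" "e \<in> A2 A" for q e
    using that by (cases "(?k, q, e)" rule: queue_step.cases) (auto simp: A2_def)
  have "?s W \<in> ?Q" if "W \<in> lists (A2 A)" for W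
    using that
  proof (induction W rule: rev_induct)
    case Nil
    show ?case using x(1) by auto
  next
    case (snoc e W)
    then show ?case using step[of "?s W" e] by (simp del: insert_iff)
  qed
  then have "?s ` lists (A2 A) \<subseteq> ?Q" by (rule image_subsetI)
  moreover have "finite ?Q" using finite_lists_length_le[OF A] by simp
  ultimately show "finite (?s ` lists (A2 A))" by (rule finite_subset)
  have mem: "W \<in> {padR (x @ \<alpha>) \<alpha> | \<alpha>. \<alpha> \<in> lists A} \<longleftrightarrow> ?s W = Some []" if "W \<in> lists (A2 A)" for W
    using that padR_in_listsD foldl_queue_step[OF _ x(2)] by fastforce
  show "Y @ Z \<in> {padR (x @ \<alpha>) \<alpha> | \<alpha>. \<alpha> \<in> lists A}"
    if "X \<in> lists (A2 A)" "Y \<in> lists (A2 A)" "Z \<in> lists (A2 A)" "?s X = ?s Y"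
      "X @ Z \<in> {padR (x @ \<alpha>) \<alpha> | \<alpha>. \<alpha> \<in> lists A}" for X Y Z
    using that mem[of "X @ Z"] mem[of "Y @ Z"] by simp
  show "{padR (x @ \<alpha>) \<alpha> | \<alpha>. \<alpha> \<in> lists A} \<subseteq> lists (A2 A)"
    using x(1) padR_in_lists[of "x @ _" A] by auto
qed (rule finite_A2[OF A])

lemma concat_map_padR_snd: "concat (map (\<lambda>e. case snd e of None \<Rightarrow> [] | Some c \<Rightarrow> [c]) (padR \<alpha> \<beta>)) = \<beta>"
proof (induction \<alpha> arbitrary: \<beta>)
  case Nil
  then show ?case by (induction \<beta>) auto
next
  case (Cons c \<alpha>)
  then show ?case by (cases \<beta>) auto
qed

text \<open>The delay language fixes the shape of the pairs, and an inverse homomorphism reading the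
  second track puts \<open>\<alpha>\<close> into \<open>K\<close>. For empty \<open>x\<close> only
  diagonal pairs remain. The common prefix \<open>y\<close> is prepended as diagonal
  letters.\<close>

lemma regular_over_padR_append_left:
  assumes K: "regular_over A K" and x: "x \<in> lists A" and y: "y \<in> lists A"
  shows "regular_over (A2 A) {padR (y @ x @ \<alpha>) (y @ \<alpha>) | \<alpha>. \<alpha> \<in> K}"
proof -
  let ?d = "\<lambda>c. (Some c, Some c)"
  have A: "finite A" and KA: "K \<subseteq> lists A" using K by (auto simp: regular_over_def)
  have d: "inj_on ?d A" "?d ` A \<subseteq> A2 A" by (auto simp: inj_on_def A2_def)
  have "regular_over (A2 A) {padR (x @ \<alpha>) \<alpha> | \<alpha>. \<alpha> \<in> K}"
  proof (cases "x = []")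
    case True
    have "{padR (x @ \<alpha>) \<alpha> | \<alpha>. \<alpha> \<in> K} = map ?d ` K"
      using padR_append_same[of _ "[]" "[]"] True by auto
    then show ?thesis using regular_over_map[OF K d finite_A2[OF A]] by simp
  next
    case False
    let ?\<phi> = "\<lambda>e :: 'a option \<times> 'a option. case snd e of None \<Rightarrow> [] | Some c \<Rightarrow> [c]"
    have "regular_over (A2 A) {W \<in> lists (A2 A). concat (map ?\<phi> W) \<in> K}"
      by (rule regular_over_concat_map_vimage[OF K]) (auto simp: A2_def A)
    then have "regular_over (A2 A) ({padR (x @ \<alpha>) \<alpha> | \<alpha>. \<alpha> \<in> lists A} \<inter> {W \<in> lists (A2 A). concat (map ?\<phi> W) \<in> K})"
      using regular_over_padR_delay[OF x False A] regular_over_Int by blast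
    moreover have "{padR (x @ \<alpha>) \<alpha> | \<alpha>. \<alpha> \<in> K} =
      {padR (x @ \<alpha>) \<alpha> | \<alpha>. \<alpha> \<in> lists A} \<inter> {W \<in> lists (A2 A). concat (map ?\<phi> W) \<in> K}"
      (is "?L = ?R1 \<inter> ?R2")
    proof
      show "?L \<subseteq> ?R1 \<inter> ?R2"
      proof
        fix W assume "W \<in> ?L"
        then obtain \<alpha> where \<alpha>: "W = padR (x @ \<alpha>) \<alpha>" "\<alpha> \<in> K" by blast
        then have "\<alpha> \<in> lists A" "W \<in> lists (A2 A)" using KA x padR_in_lists[of "x @ \<alpha>" A \<alpha>] by auto
        then show "W \<in> ?R1 \<inter> ?R2" using \<alpha> by (auto simp: concat_map_padR_snd)
      qed
    qed (auto simp: concat_map_padR_snd)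
    ultimately show ?thesis by simp
  qed
  then have "regular_over (A2 A) ((@) (map ?d y) ` {padR (x @ \<alpha>) \<alpha> | \<alpha>. \<alpha> \<in> K})"
    using y d(2) by (intro regular_over_append_left) (auto simp: lists_eq_set)
  moreover have "(@) (map ?d y) ` {padR (x @ \<alpha>) \<alpha> | \<alpha>. \<alpha> \<in> K} = {padR (y @ x @ \<alpha>) (y @ \<alpha>) | \<alpha>. \<alpha> \<in> K}"
    by (auto simp: padR_append_same)
  ultimately show ?thesis by simp
qed

text \<open>The common prefix \<open>\<alpha>\<close> is read on the diagonal, followed by the fixed
  word \<open>padR x y\<close>.\<close>

lemma regular_over_padR_append_right:
  assumes K: "regular_over A K" and x: "x \<in> lists A" and y: "y \<in> lists A"
  shows "regular_over (A2 A) {padR (\<alpha> @ x) (\<alpha> @ y) | \<alpha>. \<alpha> \<in> K}"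
proof -
  let ?d = "\<lambda>c. (Some c, Some c)"
  have d: "inj_on ?d A" "?d ` A \<subseteq> A2 A" by (auto simp: inj_on_def A2_def)
  have "regular_over (A2 A) ((\<lambda>W. W @ padR x y) ` map ?d ` K)"
    using regular_over_map[OF K d finite_A2[OF regular_over_finite[OF K]]] padR_in_lists[OF x y]
    by (rule regular_over_append_right)
  moreover have "(\<lambda>W. W @ padR x y) ` map ?d ` K = {padR (\<alpha> @ x) (\<alpha> @ y) | \<alpha>. \<alpha> \<in> K}"
    by (auto simp: padR_append_same)
  ultimately show ?thesis by simp
qed

section \<open>Relations regular under both paddings\<close>

definition pad_regular :: "'b set \<Rightarrow> ('b list \<times> 'b list) set \<Rightarrow> bool" where
  "pad_regular A P \<longleftrightarrow> regular_over (A2 A) (case_prod padR ` P) \<and> regular_over (A2 A) (case_prod padL ` P)"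

lemma pad_regular_Un: "pad_regular A P \<Longrightarrow> pad_regular A P' \<Longrightarrow> pad_regular A (P \<union> P')"
  by (simp add: pad_regular_def image_Un regular_over_Un)

text \<open>Swapping the two tracks is an injective relabelling of \<open>A2 A\<close>. It handles
  products that are longer than the factor they arise from.\<close>

lemma pad_regular_converse:
  assumes "pad_regular A P"
  shows "pad_regular A (P\<inverse>)"
proof -
  have swap: "inj_on prod.swap (A2 A)" "prod.swap ` A2 A \<subseteq> A2 A" by (auto simp: A2_def)
  have "regular_over (A2 A) (map prod.swap ` case_prod padR ` P)"
    "regular_over (A2 A) (map prod.swap ` case_prod padL ` P)"
    using assms swap by (auto simp: pad_regular_def intro!: regular_over_map dest: regular_over_finite)
  moreover have "map prod.swap ` case_prod padR ` P = case_prod padR ` (P\<inverse>)"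
    "map prod.swap ` case_prod padL ` P = case_prod padL ` (P\<inverse>)"
    by (force simp: padR_swap padL_swap image_iff)+
  ultimately show ?thesis by (simp add: pad_regular_def)
qed

text \<open>Right padding keeps \<open>\<alpha>\<close> aligned with itself; left padding shifts it,
  and reversal reduces this to the delay by \<open>rev x\<close>.\<close>

lemma pad_regular_append_right:
  assumes K: "regular_over A K" and x: "x \<in> lists A"
  shows "pad_regular A {(\<alpha> @ x, \<alpha>) | \<alpha>. \<alpha> \<in> K}"
proof -
  have "regular_over (A2 A) (rev ` {padR ([] @ rev x @ \<alpha>) ([] @ \<alpha>) | \<alpha>. \<alpha> \<in> rev ` K})"
    using K x by (intro regular_over_rev regular_over_padR_append_left) (auto simp: lists_eq_set)
  moreover have "rev ` {padR ([] @ rev x @ \<alpha>) ([] @ \<alpha>) | \<alpha>. \<alpha> \<in> rev ` K} = case_prod padL ` {(\<alpha> @ x, \<alpha>) | \<alpha>. \<alpha> \<in> K}"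
    by (force simp: rev_padR_rev[symmetric] image_iff)
  moreover have "case_prod padR ` {(\<alpha> @ x, \<alpha>) | \<alpha>. \<alpha> \<in> K} = {padR (\<alpha> @ x) (\<alpha> @ []) | \<alpha>. \<alpha> \<in> K}"
    by (force simp: image_iff)
  ultimately show ?thesis
    using regular_over_padR_append_right[OF K x, of "[]"] by (simp add: pad_regular_def)
qed

text \<open>Dual to \<open>pad_regular_append_right\<close>: now right padding produces the delay
  and left padding the alignment. The prefix \<open>y\<close> makes room for the identity letter in
  front.\<close>

lemma pad_regular_append_left:
  assumes K: "regular_over A K" and x: "x \<in> lists A" and y: "y \<in> lists A"
  shows "pad_regular A {(y @ x @ \<alpha>, y @ \<alpha>) | \<alpha>. \<alpha> \<in> K}"
proof -
  have "regular_over (A2 A) (rev ` {padR (\<alpha> @ rev x @ rev y) (\<alpha> @ rev y) | \<alpha>. \<alpha> \<in> rev ` K})"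
    using K x y by (intro regular_over_rev regular_over_padR_append_right) (auto simp: lists_eq_set)
  moreover have "rev ` {padR (\<alpha> @ rev x @ rev y) (\<alpha> @ rev y) | \<alpha>. \<alpha> \<in> rev ` K}
      = case_prod padL ` {(y @ x @ \<alpha>, y @ \<alpha>) | \<alpha>. \<alpha> \<in> K}"
    by (force simp: rev_padR_rev[symmetric] image_iff)
  moreover have "case_prod padR ` {(y @ x @ \<alpha>, y @ \<alpha>) | \<alpha>. \<alpha> \<in> K} = {padR (y @ x @ \<alpha>) (y @ \<alpha>) | \<alpha>. \<alpha> \<in> K}"
    by (force simp: image_iff)
  ultimately show ?thesis
    using regular_over_padR_append_left[OF K x y] by (simp add: pad_regular_def)
qed

section \<open>Biautomaticity\<close>

definition pclass :: "('a list \<times> 'a list) set \<Rightarrow> 'a list \<Rightarrow> 'a list set" where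
  "pclass R x = {y. pcong R x y}"

lemma pclass_eq_iff: "pclass R x = pclass R y \<longleftrightarrow> pcong R x y"
  unfolding pclass_def using pcong.refl pcong.sym pcong.trans by blast

lemma sgp_carrier_eq: "sgp_carrier R = range (pclass R)"
  by (auto simp: sgp_carrier_def pclass_def)

lemma sgp_mult_pclass: "sgp_mult R (pclass R x) (pclass R y) = pclass R (x @ y)"
proof -
  have "(\<exists>x'. pcong R x x' \<and> (\<exists>y'. pcong R y y' \<and> pcong R z (x' @ y'))) \<longleftrightarrow> pcong R (x @ y) z" for z
    by (meson pcong.refl pcong.sym pcong.trans pcong_append)
  then show ?thesis by (simp add: sgp_mult_def pclass_def)
qed

text \<open>A generator may stand for any word, in particular for the empty one, which admits a
  generator for the identity.\<close>

lemma sg_eval_pclass: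
  assumes "\<alpha> \<noteq> []"
  shows "sg_eval (sgp_mult R) (\<lambda>i. pclass R (\<rho> i)) \<alpha> = pclass R (concat (map \<rho> \<alpha>))"
proof -
  have "fold (\<lambda>j acc. sgp_mult R acc (pclass R (\<rho> j))) xs (pclass R x) = pclass R (x @ concat (map \<rho> xs))" for xs x
    by (induction xs arbitrary: x) (simp_all add: sgp_mult_pclass)
  then show ?thesis using assms by (cases \<alpha>) (simp_all add: sg_eval_def)
qed

section \<open>Multiplication relations on encoded normal forms\<close>

lemma not_has_factor_appendD:
  "\<not> has_factor u (x @ y) \<Longrightarrow> \<not> has_factor u x \<and> \<not> has_factor u y"
  by (simp add: has_factor_append)

definition encode_pair :: "'b \<Rightarrow> ('a \<Rightarrow> 'b) \<Rightarrow> 'a list \<times> 'a list \<Rightarrow> 'b list \<times> 'b list" where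
  "encode_pair e g = map_prod (\<lambda>w. e # map g w) (\<lambda>w. e # map g w)"

lemma encode_pair_converse: "(encode_pair e g ` P)\<inverse> = encode_pair e g ` (P\<inverse>)"
  by (force simp: encode_pair_def)

lemma rel_eqI: "(\<And>x y. (x, y) \<in> P \<longleftrightarrow> (x, y) \<in> Q) \<Longrightarrow> P = Q"
  by auto

text \<open>One condition on the longer word is enough, since its factor \<open>w\<close> is then
  factor-free as well. The letter \<open>e\<close> is absorbed into the common prefix.\<close>

lemma pad_regular_factor_free_right:
  fixes u y :: "'a::finite list"
  assumes g: "inj g" "range g \<subseteq> M" and M: "finite M" "e \<in> M"
  shows "pad_regular M (encode_pair e g ` {(w @ y, w) | w. \<not> has_factor u (w @ y)})"
proof -
  let ?K = "(#) e ` map g ` {w. \<not> has_factor u ([] @ w @ y)}"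
  have "regular_over M ?K"
    using g M by (intro regular_over_Cons regular_over_map[OF regular_over_factor_free]) auto
  moreover have "map g y \<in> lists M" using g(2) by (simp add: lists_eq_set) blast
  ultimately have "pad_regular M {(\<alpha> @ map g y, \<alpha>) | \<alpha>. \<alpha> \<in> ?K}" by (rule pad_regular_append_right)
  moreover have "{(\<alpha> @ map g y, \<alpha>) | \<alpha>. \<alpha> \<in> ?K} =
    encode_pair e g ` {(w @ y, w) | w. \<not> has_factor u (w @ y)}"
    by (force simp: encode_pair_def)
  ultimately show ?thesis by simp
qed

text \<open>Here \<open>e\<close> stays in front of the inserted \<open>x\<close>, so it is passed
  to \<open>pad_regular_append_left\<close> as the common prefix.\<close>

lemma pad_regular_factor_free_left:
  fixes u x :: "'a::finite list"
  assumes g: "inj g" "range g \<subseteq> M" and M: "finite M" "e \<in> M"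
  shows "pad_regular M (encode_pair e g ` {(x @ w, w) | w. \<not> has_factor u (x @ w)})"
proof -
  let ?K = "map g ` {w. \<not> has_factor u (x @ w @ [])}"
  have "regular_over M ?K"
    using g M by (intro regular_over_map[OF regular_over_factor_free]) auto
  moreover have "map g x \<in> lists M" using g(2) by (simp add: lists_eq_set) blast
  moreover have "[e] \<in> lists M" using M by simp
  ultimately have "pad_regular M {([e] @ map g x @ \<alpha>, [e] @ \<alpha>) | \<alpha>. \<alpha> \<in> ?K}"
    by (rule pad_regular_append_left)
  moreover have "{([e] @ map g x @ \<alpha>, [e] @ \<alpha>) | \<alpha>. \<alpha> \<in> ?K} =
    encode_pair e g ` {(x @ w, w) | w. \<not> has_factor u (x @ w)}"
    by (force simp: encode_pair_def)
  ultimately show ?thesis by simp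
qed

text \<open>By \<open>pcong_snoc_iff\<close> multiplying by \<open>c\<close> either appends
  \<open>c\<close>, the converse of removing it, or removes the suffix \<open>s\<close> when
  \<open>u = s @ [c]\<close>. Both are instances of \<open>pad_regular_factor_free_right\<close>.
  Empty \<open>a\<close> yields the diagonal, by \<open>unique\<close>.\<close>

lemma pad_regular_mult_right:
  fixes u :: "'a::finite list"
  assumes unique: "\<And>x y. \<lbrakk>pcong {(u, [])} x y; \<not> has_factor u x; \<not> has_factor u y\<rbrakk> \<Longrightarrow> x = y"
    and u: "u \<noteq> []" and g: "inj g" "range g \<subseteq> M" and M: "finite M" "e \<in> M" and a: "a = [] \<or> (\<exists>c. a = [c])"
  shows "pad_regular M (encode_pair e g `
    {(w, v). \<not> has_factor u w \<and> \<not> has_factor u v \<and> pcong {(u, [])} (w @ a) v})"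
    (is "pad_regular M (_ ` ?P)")
  using a
proof
  assume "a = []"
  then have "?P = {(w @ [], w) | w. \<not> has_factor u (w @ [])}"
    by (auto intro: pcong.refl dest: unique)
  then show ?thesis using pad_regular_factor_free_right[OF g M, of "[]" u] by simp
next
  assume "\<exists>c. a = [c]"
  then obtain c where a: "a = [c]" by blast
  let ?Q = "\<lambda>y. {(w @ y, w) | w. \<not> has_factor u (w @ y)}"
  have Q: "pad_regular M (encode_pair e g ` ?Q y)" for y
    by (rule pad_regular_factor_free_right[OF g M])
  have P: "(w, v) \<in> ?P \<longleftrightarrow> \<not> has_factor u w \<and> \<not> has_factor u v \<and>
      (v = w @ [c] \<or> (\<exists>s. u = s @ [c] \<and> w = v @ s))" for w v
    using pcong_snoc_iff[OF unique u, of w v c] by (auto simp: a)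
  have Qc: "(w, v) \<in> (?Q [c])\<inverse> \<longleftrightarrow> \<not> has_factor u w \<and> \<not> has_factor u v \<and> v = w @ [c]" for w v
    using not_has_factor_appendD[of u w "[c]"] by auto
  show ?thesis
  proof (cases "\<exists>s. u = s @ [c]")
    case True
    then obtain s where s: "u = s @ [c]" by blast
    have Qs: "(w, v) \<in> ?Q s \<longleftrightarrow> \<not> has_factor u w \<and> \<not> has_factor u v \<and> w = v @ s" for w v
      using not_has_factor_appendD[of u v s] by auto
    have "(w, v) \<in> ?P \<longleftrightarrow> (w, v) \<in> (?Q [c])\<inverse> \<union> ?Q s" for w v
      unfolding P Un_iff Qc Qs using s by auto
    then have "?P = (?Q [c])\<inverse> \<union> ?Q s" by (rule rel_eqI)
    then show ?thesis
      using pad_regular_Un[OF pad_regular_converse[OF Q[of "[c]"]] Q[of s]]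
      by (simp add: image_Un encode_pair_converse)
  next
    case False
    have "(w, v) \<in> ?P \<longleftrightarrow> (w, v) \<in> (?Q [c])\<inverse>" for w v
      unfolding P Qc using False by blast
    then have "?P = (?Q [c])\<inverse>" by (rule rel_eqI)
    then show ?thesis using pad_regular_converse[OF Q[of "[c]"]] by (simp add: encode_pair_converse)
  qed
qed

text \<open>Same decomposition as for right multiplication, with prefixes in place of suffixes and
  \<open>pcong_Cons_iff\<close>.\<close>

lemma pad_regular_mult_left:
  fixes u :: "'a::finite list"
  assumes unique: "\<And>x y. \<lbrakk>pcong {(u, [])} x y; \<not> has_factor u x; \<not> has_factor u y\<rbrakk> \<Longrightarrow> x = y"
    and u: "u \<noteq> []" and g: "inj g" "range g \<subseteq> M" and M: "finite M" "e \<in> M" and a: "a = [] \<or> (\<exists>c. a = [c])"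
  shows "pad_regular M (encode_pair e g `
    {(w, v). \<not> has_factor u w \<and> \<not> has_factor u v \<and> pcong {(u, [])} (a @ w) v})"
    (is "pad_regular M (_ ` ?P)")
  using a
proof
  assume "a = []"
  then have "?P = {([] @ w, w) | w. \<not> has_factor u ([] @ w)}"
    by (auto intro: pcong.refl dest: unique)
  then show ?thesis using pad_regular_factor_free_left[OF g M, of "[]" u] by simp
next
  assume "\<exists>c. a = [c]"
  then obtain c where a: "a = [c]" by blast
  let ?Q = "\<lambda>y. {(y @ w, w) | w. \<not> has_factor u (y @ w)}"
  have Q: "pad_regular M (encode_pair e g ` ?Q y)" for y
    by (rule pad_regular_factor_free_left[OF g M])
  have P: "(w, v) \<in> ?P \<longleftrightarrow> \<not> has_factor u w \<and> \<not> has_factor u v \<and>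
      (v = c # w \<or> (\<exists>s. u = c # s \<and> w = s @ v))" for w v
    using pcong_Cons_iff[OF unique u, of w v c] by (auto simp: a)
  have Qc: "(w, v) \<in> (?Q [c])\<inverse> \<longleftrightarrow> \<not> has_factor u w \<and> \<not> has_factor u v \<and> v = c # w" for w v
    using not_has_factor_appendD[of u "[c]" w] by auto
  show ?thesis
  proof (cases "\<exists>s. u = c # s")
    case True
    then obtain s where s: "u = c # s" by blast
    have Qs: "(w, v) \<in> ?Q s \<longleftrightarrow> \<not> has_factor u w \<and> \<not> has_factor u v \<and> w = s @ v" for w v
      using not_has_factor_appendD[of u s v] by auto
    have "(w, v) \<in> ?P \<longleftrightarrow> (w, v) \<in> (?Q [c])\<inverse> \<union> ?Q s" for w v
      unfolding P Un_iff Qc Qs using s by auto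
    then have "?P = (?Q [c])\<inverse> \<union> ?Q s" by (rule rel_eqI)
    then show ?thesis
      using pad_regular_Un[OF pad_regular_converse[OF Q[of "[c]"]] Q[of s]]
      by (simp add: image_Un encode_pair_converse)
  next
    case False
    have "(w, v) \<in> ?P \<longleftrightarrow> (w, v) \<in> (?Q [c])\<inverse>" for w v
      unfolding P Qc using False by blast
    then have "?P = (?Q [c])\<inverse>" by (rule rel_eqI)
    then show ?thesis using pad_regular_converse[OF Q[of "[c]"]] by (simp add: encode_pair_converse)
  qed
qed

theorem theorem3p1p4:
  fixes u :: "'a::{finite,linorder} list" and k :: nat
  assumes "k \<ge> 2" and "length u = k"
    and "GSB ({rel_poly u} :: ('a list \<Rightarrow> 'k::field) set)"
  shows "biautomatic (sgp_carrier {(u, [])}) (sgp_mult {(u, [])})"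
proof -
  let ?R = "{(u, [])}"
  have u: "u \<noteq> []" using assms by auto
  note unique = GSB_pcong_unique[OF assms(3)]
  define n where "n = card (UNIV :: 'a set)"
  obtain g :: "'a \<Rightarrow> nat" where g: "bij_betw g UNIV {0..<n}"
    using ex_bij_betw_finite_nat[of "UNIV :: 'a set"] unfolding n_def by auto
  define M where "M = {0..<Suc n}"
  have gM: "inj g" "range g \<subseteq> M" and M: "finite M" "n \<in> M"
    using g by (auto simp: bij_betw_def M_def)
  have g_less: "g c < n" for c using g by (auto simp: bij_betw_def)
  \<comment> \<open>Generators below \<open>n\<close> are the letters; the extra generator
    \<open>n\<close> represents the identity.\<close>
  define \<rho> where "\<rho> i = (if i < n then [inv g i] else [])" for i
  define \<gamma> where "\<gamma> = (\<lambda>i. pclass ?R (\<rho> i))"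
  define word where "word w = n # map g w" for w
  define L where "L = word ` {w. \<not> has_factor u w}"
  have \<rho>_g: "concat (map (\<rho> \<circ> g) w) = w" for w
    by (induction w) (simp_all add: \<rho>_def g_less gM(1))
  have \<rho>_word: "concat (map \<rho> (word w)) = w" for w
    by (simp add: word_def \<rho>_g) (simp add: \<rho>_def)
  have eval: "sg_eval (sgp_mult ?R) \<gamma> \<alpha> = pclass ?R (concat (map \<rho> \<alpha>))" if "\<alpha> \<noteq> []" for \<alpha>
    unfolding \<gamma>_def using that by (rule sg_eval_pclass)
  have word_ne: "word w \<noteq> []" for w by (simp add: word_def)
  have inj: "inj_on \<gamma> M"
  proof (rule inj_onI)
    fix i j assume ij: "i \<in> M" "j \<in> M" "\<gamma> i = \<gamma> j"
    \<comment> \<open>The words \<open>\<rho> i\<close> have length at most 1, below the length of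
      \<open>u\<close> since \<open>k \<ge> 2\<close>. Being normal forms, distinct ones give
      distinct elements.\<close>
    have "\<not> has_factor u (\<rho> i)" for i using assms(1,2) by (auto simp: has_factor_def \<rho>_def Cons_eq_append_conv append_eq_Cons_conv)
    then have "\<rho> i = \<rho> j" using ij(3) unique by (simp add: \<gamma>_def pclass_eq_iff)
    moreover have "g (inv g i) = i" if "i < n" for i
      using that g by (intro f_inv_into_f) (auto simp: bij_betw_def)
    ultimately show "i = j" using ij(1,2) by (auto simp: \<rho>_def M_def split: if_splits) (metis less_antisym)+
  qed
  have regL: "regular_over M L"
  proof -
    have "regular_over M ((#) n ` map g ` {w. \<not> has_factor u ([] @ w @ [])})"
      using gM M by (intro regular_over_Cons regular_over_map[OF regular_over_factor_free]) auto
    then show ?thesis by (simp add: L_def word_def image_image)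
  qed
  have onto: "sg_eval (sgp_mult ?R) \<gamma> ` L = sgp_carrier ?R"
  proof -
    have "sg_eval (sgp_mult ?R) \<gamma> ` L = pclass ?R ` {w. \<not> has_factor u w}"
      by (simp add: L_def image_image eval word_ne \<rho>_word)
    also have "\<dots> = range (pclass ?R)"
    proof (intro equalityI image_subsetI)
      fix x
      obtain y where "pcong ?R x y" "\<not> has_factor u y" using factor_free_representative[OF u] by blast
      then show "pclass ?R x \<in> pclass ?R ` {w. \<not> has_factor u w}"
        by (intro image_eqI[of _ _ y]) (simp_all add: pclass_eq_iff)
    qed auto
    finally show ?thesis by (simp add: sgp_carrier_eq)
  qed
  have families:
    "regular_over (A2 M) {padR \<alpha> \<beta> | \<alpha> \<beta>. \<alpha> \<in> L \<and> \<beta> \<in> L \<and> sg_eval (sgp_mult ?R) \<gamma> (f a \<alpha>) = sg_eval (sgp_mult ?R) \<gamma> \<beta>}"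
    "regular_over (A2 M) {padL \<alpha> \<beta> | \<alpha> \<beta>. \<alpha> \<in> L \<and> \<beta> \<in> L \<and> sg_eval (sgp_mult ?R) \<gamma> (f a \<alpha>) = sg_eval (sgp_mult ?R) \<gamma> \<beta>}"
    if f: "f = (\<lambda>a \<alpha>. \<alpha> @ a) \<or> f = (@)" and a: "a = [] \<or> (\<exists>i\<in>M. a = [i])" for f :: "nat list \<Rightarrow> nat list \<Rightarrow> nat list" and a
  proof -
    \<comment> \<open>Translated to the monoid, a generator is a single letter or, for
      \<open>n\<close>, the empty word, so the multiplication lemmas cover every case.\<close>
    define a' where "a' = concat (map \<rho> a)"
    have a': "a' = [] \<or> (\<exists>c. a' = [c])" using a by (auto simp: a'_def \<rho>_def)
    let ?P = "{(\<alpha>, \<beta>). \<alpha> \<in> L \<and> \<beta> \<in> L \<and> sg_eval (sgp_mult ?R) \<gamma> (f a \<alpha>) = sg_eval (sgp_mult ?R) \<gamma> \<beta>}"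
    have "pad_regular M ?P"
      using f
    proof
      assume f: "f = (\<lambda>a \<alpha>. \<alpha> @ a)"
      have "sg_eval (sgp_mult ?R) \<gamma> (f a (word w)) = sg_eval (sgp_mult ?R) \<gamma> (word v) \<longleftrightarrow> pcong ?R (w @ a') v" for w v
        by (simp add: f eval word_ne \<rho>_word pclass_eq_iff a'_def)
      then have "?P = encode_pair n g ` {(w, v). \<not> has_factor u w \<and> \<not> has_factor u v \<and> pcong ?R (w @ a') v}"
        by (auto simp: L_def encode_pair_def word_def)
      then show ?thesis using pad_regular_mult_right[OF unique u gM M a'] by simp
    next
      assume f: "f = (@)"
      have "sg_eval (sgp_mult ?R) \<gamma> (f a (word w)) = sg_eval (sgp_mult ?R) \<gamma> (word v) \<longleftrightarrow> pcong ?R (a' @ w) v" for w v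
        by (simp add: f eval word_ne \<rho>_word pclass_eq_iff a'_def)
      then have "?P = encode_pair n g ` {(w, v). \<not> has_factor u w \<and> \<not> has_factor u v \<and> pcong ?R (a' @ w) v}"
        by (auto simp: L_def encode_pair_def word_def)
      then show ?thesis using pad_regular_mult_left[OF unique u gM M a'] by simp
    qed
    moreover have "case_prod h ` ?P = {h \<alpha> \<beta> | \<alpha> \<beta>. \<alpha> \<in> L \<and> \<beta> \<in> L \<and> sg_eval (sgp_mult ?R) \<gamma> (f a \<alpha>) = sg_eval (sgp_mult ?R) \<gamma> \<beta>}"
      for h :: "nat list \<Rightarrow> nat list \<Rightarrow> (nat option \<times> nat option) list"
      by auto
    ultimately show
      "regular_over (A2 M) {padR \<alpha> \<beta> | \<alpha> \<beta>. \<alpha> \<in> L \<and> \<beta> \<in> L \<and> sg_eval (sgp_mult ?R) \<gamma> (f a \<alpha>) = sg_eval (sgp_mult ?R) \<gamma> \<beta>}"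
      "regular_over (A2 M) {padL \<alpha> \<beta> | \<alpha> \<beta>. \<alpha> \<in> L \<and> \<beta> \<in> L \<and> sg_eval (sgp_mult ?R) \<gamma> (f a \<alpha>) = sg_eval (sgp_mult ?R) \<gamma> \<beta>}"
      by (simp_all add: pad_regular_def)
  qed
  show ?thesis
    unfolding biautomatic_def
  proof (intro exI[of _ "Suc n"] exI[of _ \<gamma>] exI[of _ L] conjI allI impI, fold M_def)
    show "\<gamma> ` M \<subseteq> sgp_carrier ?R" by (auto simp: \<gamma>_def sgp_carrier_eq)
    show "L \<subseteq> lists M - {[]}" using regular_over_subset[OF regL] word_ne by (auto simp: L_def)
  next
    fix a :: "nat list" assume a: "a = [] \<or> (\<exists>i\<in>M. a = [i])"
    show "regular_over (A2 M) {padR \<alpha> \<beta> | \<alpha> \<beta>. \<alpha> \<in> L \<and> \<beta> \<in> L \<and>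
        sg_eval (sgp_mult ?R) \<gamma> (\<alpha> @ a) = sg_eval (sgp_mult ?R) \<gamma> \<beta>}"
      "regular_over (A2 M) {padL \<alpha> \<beta> | \<alpha> \<beta>. \<alpha> \<in> L \<and> \<beta> \<in> L \<and>
        sg_eval (sgp_mult ?R) \<gamma> (\<alpha> @ a) = sg_eval (sgp_mult ?R) \<gamma> \<beta>}"
      using families[OF disjI1[OF HOL.refl] a] by simp_all
    show "regular_over (A2 M) {padR \<alpha> \<beta> | \<alpha> \<beta>. \<alpha> \<in> L \<and> \<beta> \<in> L \<and>
        sg_eval (sgp_mult ?R) \<gamma> (a @ \<alpha>) = sg_eval (sgp_mult ?R) \<gamma> \<beta>}"
      "regular_over (A2 M) {padL \<alpha> \<beta> | \<alpha> \<beta>. \<alpha> \<in> L \<and> \<beta> \<in> L \<and>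
        sg_eval (sgp_mult ?R) \<gamma> (a @ \<alpha>) = sg_eval (sgp_mult ?R) \<gamma> \<beta>}"
      using families[OF disjI2[OF HOL.refl] a] by simp_all
  qed (fact inj regL onto)+
qed

end
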